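(* Let $f,g,h$ be twice continuously differentiable, let $(x^*,y^* )$ be a local minimum of the reformulation (R) satisfying CC-LICQ, and let $(\lambda^*,\mu^*,\gamma^* )$ be the unique S-stationary multipliers for $(x^*,y^* )$. Then $$d_x^T\left(\nabla^2f(x^* )+\sum_{i=1}^m\lambda^*_i\nabla^2 g_i(x^* )+\sum_{i=1}^p\mu^*_i\nabla^2h_i(x^* )\right)d_x\geq 0$$ for all $(d_x,d_y)\in \mathcal{C}^{CC}_Z(x^*,y^* )$.
   Context: Setting. $f:\mathbb{R}^n\to\mathbb{R}$, $g:\mathbb{R}^n\to\mathbb{R}^m$, $h:\mathbb{R}^n\to\mathbb{R}^p$ are continuously differentiable, $\kappa<n$ is an integer, $X=\{x\in\mathbb{R}^n\mid g(x)\le 0,\ h(x)=0\}$, $\|x\|_0$ is the number of nonzero components of $x$, and $\{x\in X\mid \|x\|_0\le\kappa\}\neq\emptyset$. The reformulation (R) is: minimize $f(x)$ over $(x,y)\in\mathbb{R}^n\times\mathbb{R}^n$ subject to $g(x)\le0$, $h(x)=0$, $0\le y\le e$, $e^Ty\ge n-\kappa$, $x\circ y=0$, where $e$ is the all-ones vector and $\circ$ is the componentwise product. $Z$ denotes the feasible set of (R). $e_i$ denotes the $i$-th unit vector. Index sets for $(x^*,y^* )\in Z$: $I_g=I_g(x^* )=\{i\mid g_i(x^* )=0\}$, $I_0=I_0(x^* )=\{i\mid x_i^*=0\}$, $I_{\pm0}=\{i\mid x_i^*\ne0,\ y_i^*=0\}$, $I_{00}=\{i\mid x_i^*=0,\ y_i^*=0\}$,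 $I_{0+}=\{i\mid x_i^*=0,\ y_i^*\in(0,1)\}$, $I_{01}=\{i\mid x_i^*=0,\ y_i^*=1\}$. S-stationarity: $(x^*,y^* )\in Z$ is S-stationary with S-stationary multipliers $(\lambda^*,\mu^*,\gamma^* )\in\mathbb{R}^m\times\mathbb{R}^p\times\mathbb{R}^n$ if $\nabla f(x^* )+\sum_{i=1}^m\lambda_i^*\nabla g_i(x^* )+\sum_{i=1}^p\mu_i^*\nabla h_i(x^* )+\sum_{i=1}^n\gamma_i^*e_i=0$, $\lambda_i^*\ge0$ and $\lambda_i^*g_i(x^* )=0$ for all $i=1,\dots,m$, and $\gamma_i^*=0$ for all $i\in I_{\pm0}\cup I_{00}$. (It is known that a local minimum of (R) satisfying CC-LICQ is S-stationary with unique multipliers.) CC-LICQ holds at $(x^*,y^* )$ if the vectors $\nabla g_i(x^* )$ ($i\in I_g(x^* )$), $\nabla h_i(x^* )$ ($i=1,\dots,p$), $e_i$ ($i\in I_0(x^* )$) are linearly independent. CC-linearisation cone: $\mathcal{L}^{CC}_Z(x^*,y^* )$ is the set of all $(d_x,d_y)\in\mathbb{R}^n\times\mathbb{R}^n$ with $\nabla g_i(x^* )^Td_x\le0$ for $i\in I_g$; $\nabla h_i(x^* )^Td_x=0$ for $i=1,\dots,p$; $e^Td_y\ge0$ if $e^Ty^*=n-\kappa$; $e_i^Td_y=0$ for $i\in I_{\pm0}$; $e_i^Td_y\ge0$ for $i\in I_{00}$; $e_i^Td_y\le0$ for $i\in I_{01}$; $e_i^Td_x=0$ for $i\in I_{01}\cup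 I_{0+}$; $(e_i^Td_x)(e_i^Td_y)=0$ for $i\in I_{00}$. CC-critical cone: $\mathcal{C}^{CC}_Z(x^*,y^* )=\{(d_x,d_y)\in\mathcal{L}^{CC}_Z(x^*,y^* )\mid\nabla f(x^* )^Td_x\le0\}$. *)

theory Defs
  imports "HOL-Analysis.Analysis"
begin

text \<open>
  The constraint maps g and h with values in m- and p-dimensional space are given by
  their component functions \<open>g 1, \<dots>, g m\<close> and \<open>h 1, \<dots>, h p\<close>. The numbers m and p are
  naturals rather than index types so that m = 0 and p = 0 (no constraints of that kind)
  are included.

  On \<^typ>\<open>real ^ 'n\<close> the order is componentwise, \<open>1\<close> is the all-ones vector, \<open>*\<close> is
  the componentwise product, and \<open>axis i 1\<close> is the i-th unit vector.
\<close>

definition gradient :: "(real ^ 'n \<Rightarrow> real) \<Rightarrow> real ^ 'n \<Rightarrow> real ^ 'n" where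
  "gradient f x = (THE D. GDERIV f x :> D)"

definition hessian :: "(real ^ 'n \<Rightarrow> real) \<Rightarrow> real ^ 'n \<Rightarrow> real ^ 'n ^ 'n" where
  "hessian f x = jacobian (gradient f) (at x)"

definition twice_continuously_differentiable :: "(real ^ 'n \<Rightarrow> real) \<Rightarrow> bool" where
  "twice_continuously_differentiable f \<longleftrightarrow>
     (\<forall>x. f differentiable (at x)) \<and>
     (\<forall>x. gradient f differentiable (at x)) \<and>
     continuous_on UNIV (hessian f)"

definition constraint_set ::
  "nat \<Rightarrow> (nat \<Rightarrow> real ^ 'n \<Rightarrow> real) \<Rightarrow> nat \<Rightarrow> (nat \<Rightarrow> real ^ 'n \<Rightarrow> real) \<Rightarrow> (real ^ 'n) set"
where
  "constraint_set m g p h = {x. (\<forall>i\<in>{1..m}. g i x \<le> 0) \<and> (\<forall>i\<in>{1..p}. h i x = 0)}"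

definition norm0 :: "real ^ 'n \<Rightarrow> nat" where
  "norm0 x = card {i. x $ i \<noteq> 0}"

definition feasible_R ::
  "nat \<Rightarrow> (nat \<Rightarrow> real ^ 'n \<Rightarrow> real) \<Rightarrow> nat \<Rightarrow> (nat \<Rightarrow> real ^ 'n \<Rightarrow> real) \<Rightarrow> int
     \<Rightarrow> ((real ^ 'n) \<times> (real ^ 'n)) set"
where
  "feasible_R m g p h \<kappa> =
     {(x, y). x \<in> constraint_set m g p h \<and> 0 \<le> y \<and> y \<le> 1 \<and>
              1 \<bullet> y \<ge> real CARD('n) - real_of_int \<kappa> \<and> x * y = 0}"

definition local_min_on :: "('a::metric_space \<Rightarrow> real) \<Rightarrow> 'a set \<Rightarrow> 'a \<Rightarrow> bool" where
  "local_min_on F S z \<longleftrightarrow> z \<in> S \<and> (\<exists>\<epsilon>>0. \<forall>w \<in> S \<inter> ball z \<epsilon>. F z \<le> F w)"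

definition local_min_R ::
  "(real ^ 'n \<Rightarrow> real) \<Rightarrow> nat \<Rightarrow> (nat \<Rightarrow> real ^ 'n \<Rightarrow> real) \<Rightarrow> nat \<Rightarrow> (nat \<Rightarrow> real ^ 'n \<Rightarrow> real) \<Rightarrow> int
     \<Rightarrow> real ^ 'n \<Rightarrow> real ^ 'n \<Rightarrow> bool"
where
  "local_min_R f m g p h \<kappa> x y \<longleftrightarrow> local_min_on (\<lambda>(x, y). f x) (feasible_R m g p h \<kappa>) (x, y)"

definition I_g :: "nat \<Rightarrow> (nat \<Rightarrow> real ^ 'n \<Rightarrow> real) \<Rightarrow> real ^ 'n \<Rightarrow> nat set" where
  "I_g m g x = {i \<in> {1..m}. g i x = 0}"

definition I_0 :: "real ^ 'n \<Rightarrow> 'n set" where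
  "I_0 x = {i. x $ i = 0}"

definition I_pm0 :: "real ^ 'n \<Rightarrow> real ^ 'n \<Rightarrow> 'n set" where
  "I_pm0 x y = {i. x $ i \<noteq> 0 \<and> y $ i = 0}"

definition I_00 :: "real ^ 'n \<Rightarrow> real ^ 'n \<Rightarrow> 'n set" where
  "I_00 x y = {i. x $ i = 0 \<and> y $ i = 0}"

definition I_0p :: "real ^ 'n \<Rightarrow> real ^ 'n \<Rightarrow> 'n set" where
  "I_0p x y = {i. x $ i = 0 \<and> y $ i \<in> {0<..<1}}"

definition I_01 :: "real ^ 'n \<Rightarrow> real ^ 'n \<Rightarrow> 'n set" where
  "I_01 x y = {i. x $ i = 0 \<and> y $ i = 1}"

definition S_stationary_multipliers ::
  "(real ^ 'n \<Rightarrow> real) \<Rightarrow> nat \<Rightarrow> (nat \<Rightarrow> real ^ 'n \<Rightarrow> real) \<Rightarrow> nat \<Rightarrow> (nat \<Rightarrow> real ^ 'n \<Rightarrow> real) \<Rightarrow> int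
     \<Rightarrow> real ^ 'n \<Rightarrow> real ^ 'n \<Rightarrow> (nat \<Rightarrow> real) \<Rightarrow> (nat \<Rightarrow> real) \<Rightarrow> real ^ 'n \<Rightarrow> bool"
where
  "S_stationary_multipliers f m g p h \<kappa> x y lam mu gam \<longleftrightarrow>
     (x, y) \<in> feasible_R m g p h \<kappa> \<and>
     gradient f x + (\<Sum>i=1..m. lam i *\<^sub>R gradient (g i) x)
       + (\<Sum>i=1..p. mu i *\<^sub>R gradient (h i) x)
       + (\<Sum>i\<in>UNIV. gam $ i *\<^sub>R axis i 1) = 0 \<and>
     (\<forall>i\<in>{1..m}. lam i \<ge> 0 \<and> lam i * g i x = 0) \<and>
     (\<forall>i \<in> I_pm0 x y \<union> I_00 x y. gam $ i = 0)"

text \<open>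
  Linear independence of a family: \<^const>\<open>independent\<close> alone speaks about the set of
  vectors and would ignore repetitions, hence the injectivity condition.
\<close>

definition independent_family :: "('i \<Rightarrow> 'a::real_vector) \<Rightarrow> 'i set \<Rightarrow> bool" where
  "independent_family v I \<longleftrightarrow> inj_on v I \<and> independent (v ` I)"

definition CC_LICQ ::
  "nat \<Rightarrow> (nat \<Rightarrow> real ^ 'n \<Rightarrow> real) \<Rightarrow> nat \<Rightarrow> (nat \<Rightarrow> real ^ 'n \<Rightarrow> real) \<Rightarrow> real ^ 'n \<Rightarrow> bool"
where
  "CC_LICQ m g p h x \<longleftrightarrow>
     independent_family
       (case_sum (\<lambda>i. gradient (g i) x) (case_sum (\<lambda>i. gradient (h i) x) (\<lambda>i. axis i 1)))
       (I_g m g x <+> ({1..p} <+> I_0 x))"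

definition CC_linearisation_cone ::
  "nat \<Rightarrow> (nat \<Rightarrow> real ^ 'n \<Rightarrow> real) \<Rightarrow> nat \<Rightarrow> (nat \<Rightarrow> real ^ 'n \<Rightarrow> real) \<Rightarrow> int
     \<Rightarrow> real ^ 'n \<Rightarrow> real ^ 'n \<Rightarrow> ((real ^ 'n) \<times> (real ^ 'n)) set"
where
  "CC_linearisation_cone m g p h \<kappa> x y =
     {(dx, dy).
        (\<forall>i \<in> I_g m g x. gradient (g i) x \<bullet> dx \<le> 0) \<and>
        (\<forall>i \<in> {1..p}. gradient (h i) x \<bullet> dx = 0) \<and>
        (1 \<bullet> y = real CARD('n) - real_of_int \<kappa> \<longrightarrow> 1 \<bullet> dy \<ge> 0) \<and>
        (\<forall>i \<in> I_pm0 x y. axis i 1 \<bullet> dy = 0) \<and>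
        (\<forall>i \<in> I_00 x y. axis i 1 \<bullet> dy \<ge> 0) \<and>
        (\<forall>i \<in> I_01 x y. axis i 1 \<bullet> dy \<le> 0) \<and>
        (\<forall>i \<in> I_01 x y \<union> I_0p x y. axis i 1 \<bullet> dx = 0) \<and>
        (\<forall>i \<in> I_00 x y. (axis i 1 \<bullet> dx) * (axis i 1 \<bullet> dy) = 0)}"

definition CC_critical_cone ::
  "(real ^ 'n \<Rightarrow> real) \<Rightarrow> nat \<Rightarrow> (nat \<Rightarrow> real ^ 'n \<Rightarrow> real) \<Rightarrow> nat \<Rightarrow> (nat \<Rightarrow> real ^ 'n \<Rightarrow> real) \<Rightarrow> int
     \<Rightarrow> real ^ 'n \<Rightarrow> real ^ 'n \<Rightarrow> ((real ^ 'n) \<times> (real ^ 'n)) set"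
where
  "CC_critical_cone f m g p h \<kappa> x y =
     {(dx, dy) \<in> CC_linearisation_cone m g p h \<kappa> x y. gradient f x \<bullet> dx \<le> 0}"

end

theory Submission
  imports Defs
begin

text \<open>
  Freeze \<open>y\<close>. Every \<open>z\<close> in the constraint set that vanishes on the
  support of \<open>y\<close> gives a feasible pair \<open>(z, y)\<close>, so \<open>x\<close> is
  a local minimum of \<open>f\<close> under the smooth constraints \<open>g z \<le> 0\<close>,
  \<open>h z = 0\<close> and \<open>z $ i = 0\<close> for \<open>i\<close> in the support of
  \<open>y\<close>. Complementarity makes this support a subset of \<open>I_0 x\<close>, namely
  \<open>I_01 \<union> I_0p\<close>, so CC-LICQ contains the ordinary linear independence
  constraint qualification (LICQ) for this nonlinear program. An S-stationary
  \<open>\<gamma>\<close> vanishes outside the support of \<open>y\<close>; hence S-stationary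
  multipliers are Lagrange multipliers of the program. Finally, the first component
  \<open>dx\<close> of a CC-critical direction is critical for the program. The theorem is thus an
  instance of the classical second-order necessary condition under LICQ,
  \<open>second_order_necessary_condition_LICQ\<close>; the Hessians of the coordinate constraints
  vanish.

  The classical condition rests on two facts. By the inverse function theorem, LICQ provides a
  curve \<open>\<xi>\<close> through \<open>x\<close> with velocity \<open>d\<close> that keeps
  the equality constraints, and those active inequality constraints whose gradients are orthogonal
  to \<open>d\<close>, equal to zero (\<open>zero_set_curve_with_tangent\<close>). For small
  positive parameters \<open>\<xi>\<close> is feasible, because the other active constraints
  decrease along it and the inactive ones stay negative, and the Lagrangian \<open>L\<close>
  agrees with \<open>f\<close> on it, because all these constraints have zero multipliers. So
  \<open>L\<close> does not fall below \<open>L x\<close> along \<open>\<xi>\<close>, while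
  \<open>x\<close> is a critical point of \<open>L\<close>; this forces the Hessian of
  \<open>L\<close> at \<open>x\<close> to be nonnegative at \<open>d\<close>
  (\<open>second_order_along_curve\<close>).
\<close>

section \<open>Gradients and linearly independent families\<close>

lemma gderiv_unique:
  assumes "GDERIV f x :> D" and "GDERIV f x :> E"
  shows "D = E"
proof -
  have "(\<lambda>h. h \<bullet> D) = (\<lambda>h. h \<bullet> E)"
    using has_derivative_unique[OF assms[unfolded gderiv_def]] .
  from fun_cong[OF this, of "D - E"] have "(D - E) \<bullet> (D - E) = 0"
    by (simp add: inner_diff_right)
  then show ?thesis by simp
qed

lemma gderiv_gradient:
  fixes f :: "real ^ 'n \<Rightarrow> real"
  assumes "f differentiable (at x)"
  shows "GDERIV f x :> gradient f x"
proof -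
  obtain f' where f': "(f has_derivative f') (at x)"
    using assms unfolding differentiable_def by blast
  then have lin: "linear f'"
    by (rule has_derivative_linear)
  \<comment> \<open>The vector that represents the functional \<open>f'\<close>.\<close>
  have "f' u = u \<bullet> adjoint f' 1" for u
    using adjoint_works[OF lin, of u 1] by (simp add: inner_commute)
  then have "f' = (\<lambda>h. h \<bullet> adjoint f' 1)" by blast
  with f' have D: "GDERIV f x :> adjoint f' 1"
    unfolding gderiv_def by simp
  show ?thesis
    unfolding gradient_def
    by (rule theI[where P = "\<lambda>D. GDERIV f x :> D" and a = "adjoint f' 1"])
      (rule D, rule gderiv_unique[OF _ D])
qed

lemma gradient_has_derivative_hessian:
  assumes "twice_continuously_differentiable f"
  shows "(gradient f has_derivative (\<lambda>v. hessian f x *v v)) (at x)"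
  using assms unfolding twice_continuously_differentiable_def hessian_def jacobian_works[symmetric]
  by blast

lemma independent_family_coefficients_zero:
  assumes "independent_family v I" and "finite I"
    and "(\<Sum>i\<in>I. r i *\<^sub>R v i) = 0" and "i \<in> I"
  shows "r i = 0"
proof -
  have inj: "inj_on v I" and ind: "independent (v ` I)"
    using assms(1) unfolding independent_family_def by auto
  have "(\<Sum>w\<in>v ` I. r (the_inv_into I v w) *\<^sub>R w) = 0"
    using inj assms(3) by (simp add: sum.reindex the_inv_into_f_f)
  then have "r (the_inv_into I v (v i)) = 0"
    using ind assms(2,4) by (intro independentD[of "v ` I" "v ` I"]) auto
  then show ?thesis
    using inj assms(4) by (simp add: the_inv_into_f_f)
qed

lemma independent_family_subset:
  assumes "independent_family v I" and "J \<subseteq> I"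
  shows "independent_family v J"
  using assms unfolding independent_family_def
  by (meson image_mono independent_mono inj_on_subset)

section \<open>Curves in the zero set of independent constraints\<close>

text \<open>
  The constraint map is completed to a map of the whole space into itself, to which the inverse
  function theorem applies. Let \<open>S\<close> be the orthogonal complement of the gradients \<open>a i x\<close>, let \<open>B\<close>
  be a finite spanning set of \<open>S\<close>, and put
  \<open>\<Phi> z = (\<Sum>b\<in>B. (b \<bullet> (z - x)) *\<^sub>R b) + (\<Sum>i\<in>I. c i z *\<^sub>R a i x)\<close>. The two sums lie in the
  complementary spaces \<open>S\<close> and \<open>span (a i x)\<close>, so where \<open>\<Phi> z\<close> lies in \<open>S\<close> the second sum is zero,
  and independence gives \<open>c i z = 0\<close>. The curve is the preimage under \<open>\<Phi>\<close> of the line in \<open>S\<close> spanned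
  by \<open>e\<close>, the image of \<open>d\<close> under the derivative of \<open>\<Phi>\<close> at \<open>x\<close>.
\<close>

lemma zero_set_curve_with_tangent:
  fixes c :: "'i \<Rightarrow> 'a::euclidean_space \<Rightarrow> real" and a :: "'i \<Rightarrow> 'a \<Rightarrow> 'a"
  assumes fin: "finite I"
    and der: "\<And>i z. i \<in> I \<Longrightarrow> GDERIV (c i) z :> a i z"
    and cont: "\<And>i. i \<in> I \<Longrightarrow> continuous_on UNIV (a i)"
    and zero: "\<And>i. i \<in> I \<Longrightarrow> c i x = 0"
    and ind: "independent_family (\<lambda>i. a i x) I"
    and tangent: "\<And>i. i \<in> I \<Longrightarrow> a i x \<bullet> d = 0"
  obtains \<xi> :: "real \<Rightarrow> 'a" where "\<xi> 0 = x" and "(\<xi> has_vector_derivative d) (at 0)"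
    and "\<forall>\<^sub>F t in nhds 0. \<forall>i\<in>I. c i (\<xi> t) = 0"
proof -
  define S where "S = {v. \<forall>i\<in>I. a i x \<bullet> v = 0}"
  have S: "subspace S"
    unfolding S_def by (auto simp: subspace_def inner_add_right)
  obtain B where B: "B \<subseteq> S" "independent B" "S \<subseteq> span B" and "card B = dim S"
    by (rule basis_exists)
  have finB: "finite B"
    using B(2) by (rule finiteI_independent)
  define \<Phi> where "\<Phi> z = (\<Sum>b\<in>B. (b \<bullet> (z - x)) *\<^sub>R b) + (\<Sum>i\<in>I. c i z *\<^sub>R a i x)" for z
  define \<Phi>' where "\<Phi>' z u = (\<Sum>b\<in>B. (b \<bullet> u) *\<^sub>R b) + (\<Sum>i\<in>I. (u \<bullet> a i z) *\<^sub>R a i x)" for z u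
  have bl: "bounded_linear (\<Phi>' z)" for z
    unfolding linear_conv_bounded_linear[symmetric] \<Phi>'_def
    by (rule linearI)
      (simp_all add: inner_add_left inner_add_right scaleR_add_left scaleR_add_right sum.distrib
        scaleR_sum_right)
  have app: "blinfun_apply (Blinfun (\<Phi>' z)) = \<Phi>' z" for z
    using bl by (rule bounded_linear_Blinfun_apply)
  have der\<Phi>: "(\<Phi> has_derivative blinfun_apply (Blinfun (\<Phi>' z))) (at z)" for z
    unfolding app \<Phi>_def \<Phi>'_def
    by (auto intro!: derivative_eq_intros der[unfolded gderiv_def])
  have cont\<Phi>': "continuous_on UNIV (\<lambda>z. Blinfun (\<Phi>' z))"
    by (rule continuous_on_blinfun_componentwise) (auto simp: app \<Phi>'_def intro!: continuous_intros cont)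
  have \<Phi>x: "\<Phi> x = 0"
    by (simp add: \<Phi>_def zero)
  \<comment> \<open>\<open>u \<bullet> \<Phi>' x u\<close> is a sum of squares; if it vanishes, \<open>u\<close> is orthogonal to all \<open>a i x\<close>, hence
    lies in \<open>S\<close>, and is orthogonal to \<open>B\<close>, hence to \<open>S\<close>.\<close>
  have "u = 0" if "\<Phi>' x u = 0" for u
  proof -
    have "0 = u \<bullet> \<Phi>' x u" by (simp add: that)
    also have "\<dots> = (\<Sum>b\<in>B. (b \<bullet> u)\<^sup>2) + (\<Sum>i\<in>I. (u \<bullet> a i x)\<^sup>2)"
      unfolding \<Phi>'_def
      by (simp add: inner_add_right inner_sum_right power2_eq_square inner_commute)
    finally have "(\<Sum>b\<in>B. (b \<bullet> u)\<^sup>2) = 0 \<and> (\<Sum>i\<in>I. (u \<bullet> a i x)\<^sup>2) = 0"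
      by (smt (verit) sum_nonneg zero_le_power2)
    then have "\<forall>b\<in>B. b \<bullet> u = 0" and "u \<in> S"
      using fin finB by (auto simp: sum_nonneg_eq_0_iff S_def inner_commute)
    then have "orthogonal u w" if "w \<in> span B" for w
      using that by (intro orthogonal_to_span[of w B]) (auto simp: orthogonal_def inner_commute)
    then have "orthogonal u u"
      using B(3) \<open>u \<in> S\<close> by blast
    then show "u = 0" by (simp add: orthogonal_def)
  qed
  then have inj: "inj (\<Phi>' x)"
    using bl by (intro iffD2[OF linear_injective_0]) (auto simp: bounded_linear.linear)
  then obtain k where k: "linear k" "k \<circ> \<Phi>' x = id"
    using bounded_linear.linear[OF bl] linear_injective_left_inverse by blast
  have kblin: "bounded_linear k"
    using k(1) linear_conv_bounded_linear by blast
  have "Blinfun k o\<^sub>L Blinfun (\<Phi>' x) = id_blinfun"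
    using k(2) by (intro blinfun_eqI)
      (simp add: app bounded_linear_Blinfun_apply[OF kblin] fun_eq_iff)
  from inverse_function_theorem[OF open_UNIV der\<Phi> cont\<Phi>' UNIV_I this]
  obtain U V \<psi> \<psi>' where U: "open U" "x \<in> U" and V: "open V" "0 \<in> V" and hom: "homeomorphism U V \<Phi> \<psi>"
    and der\<psi>: "\<And>y. y \<in> V \<Longrightarrow> (\<psi> has_derivative \<psi>' y) (at y)"
    and \<psi>': "\<And>y. y \<in> V \<Longrightarrow> \<psi>' y = inv (\<Phi>' (\<psi> y))"
    unfolding app \<Phi>x by metis
  have \<psi>0: "\<psi> 0 = x"
    using hom U(2) \<Phi>x by (metis homeomorphism_apply1)
  define e where "e = \<Phi>' x d"
  define \<xi> where "\<xi> t = \<psi> (t *\<^sub>R e)" for t :: real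
  have e: "e = (\<Sum>b\<in>B. (b \<bullet> d) *\<^sub>R b)"
    using tangent by (simp add: e_def \<Phi>'_def inner_commute)
  have "\<psi>' 0 e = d"
    using inj by (simp add: \<psi>'[OF V(2)] \<psi>0 e_def)
  have "(\<psi> has_derivative \<psi>' 0) (at ((\<lambda>t. t *\<^sub>R e) 0))"
    using der\<psi>[OF V(2)] by simp
  moreover have "((\<lambda>t::real. t *\<^sub>R e) has_derivative (\<lambda>t. t *\<^sub>R e)) (at 0)"
    by (auto intro!: derivative_eq_intros)
  ultimately have "(\<psi> \<circ> (\<lambda>t. t *\<^sub>R e) has_derivative \<psi>' 0 \<circ> (\<lambda>t. t *\<^sub>R e)) (at (0::real))"
    by (intro diff_chain_at)
  moreover have "\<psi>' 0 \<circ> (\<lambda>t. t *\<^sub>R e) = (\<lambda>t. t *\<^sub>R d)"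
    using \<open>\<psi>' 0 e = d\<close> linear_cmul[OF has_derivative_linear[OF der\<psi>[OF V(2)]]]
    by (auto simp: fun_eq_iff)
  ultimately have 2: "(\<xi> has_vector_derivative d) (at 0)"
    unfolding has_vector_derivative_def \<xi>_def comp_def by simp
  have "((\<lambda>t::real. t *\<^sub>R e) \<longlongrightarrow> 0 *\<^sub>R e) (nhds 0)"
    by (intro tendsto_intros filterlim_ident)
  then have "\<forall>\<^sub>F t in nhds (0::real). t *\<^sub>R e \<in> V"
    using V topological_tendstoD by fastforce
  moreover have "c i (\<xi> t) = 0" if "t *\<^sub>R e \<in> V" "i \<in> I" for t i
  proof -
    define z where "z = \<xi> t"
    have "\<Phi> z = t *\<^sub>R e"
      unfolding z_def \<xi>_def using hom that(1) by (rule homeomorphism_apply2)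
    then have w: "(\<Sum>i\<in>I. c i z *\<^sub>R a i x) = t *\<^sub>R e - (\<Sum>b\<in>B. (b \<bullet> (z - x)) *\<^sub>R b)"
      (is "?w = _") by (simp add: \<Phi>_def algebra_simps)
    \<comment> \<open>A combination of the gradients that lies in \<open>S\<close> is orthogonal to itself.\<close>
    have "?w \<in> S"
      unfolding w e using B(1) S
      by (intro subspace_diff subspace_scale subspace_sum) auto
    have "?w \<bullet> ?w = (\<Sum>i\<in>I. c i z * (a i x \<bullet> ?w))"
      by (simp add: inner_sum_left)
    also have "\<dots> = 0"
      using \<open>?w \<in> S\<close> unfolding S_def by (intro sum.neutral) auto
    finally have "?w = 0" by simp
    then show ?thesis
      using independent_family_coefficients_zero[OF ind fin, of "\<lambda>i. c i z" i] that(2)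
      unfolding z_def by blast
  qed
  ultimately have 3: "\<forall>\<^sub>F t in nhds 0. \<forall>i\<in>I. c i (\<xi> t) = 0"
    by (auto elim!: eventually_mono)
  show thesis
    using that[OF _ 2 3] by (simp add: \<xi>_def \<psi>0)
qed

section \<open>The classical second-order necessary condition\<close>

text \<open>
  The mean value theorem on the segment from \<open>x\<close> to \<open>\<xi> t = x + w\<close> writes \<open>L (\<xi> t) - L x\<close> as
  \<open>w \<bullet> G (x + s *\<^sub>R w)\<close> with \<open>0 < s < 1\<close>, and \<open>G\<close> there is \<open>s *\<^sub>R H w\<close> up to an error of norm at most
  \<open>e * s * norm w\<close>. The unknown factor \<open>s\<close> is positive and cancels from the resulting inequality;
  dividing by \<open>t\<^sup>2\<close> and letting first \<open>t\<close> and then \<open>e\<close> tend to zero gives the claim.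
\<close>

lemma second_order_along_curve:
  fixes L :: "'a::real_inner \<Rightarrow> real"
  assumes der: "\<And>z. GDERIV L z :> G z"
    and crit: "G x = 0"
    and der2: "(G has_derivative H) (at x)"
    and \<xi>0: "\<xi> 0 = x"
    and \<xi>': "(\<xi> has_vector_derivative d) (at_right 0)"
    and min: "\<forall>\<^sub>F t in at_right (0::real). L x \<le> L (\<xi> t)"
  shows "0 \<le> d \<bullet> H d"
proof -
  have bl: "bounded_linear H"
    using der2 by (rule has_derivative_bounded_linear)
  define q where "q t = (1 / t) *\<^sub>R (\<xi> t - x)" for t
  have q: "(q \<longlongrightarrow> d) (at_right 0)"
  proof -
    have "((\<lambda>t. (1 / norm (t - 0)) *\<^sub>R (\<xi> t - (\<xi> 0 + (t - 0) *\<^sub>R d))) \<longlongrightarrow> 0) (at_right 0)"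
      using \<xi>' unfolding has_vector_derivative_def has_derivative_within by blast
    moreover have "\<forall>\<^sub>F t in at_right 0.
        (1 / norm (t - 0)) *\<^sub>R (\<xi> t - (\<xi> 0 + (t - 0) *\<^sub>R d)) = q t - d"
      using eventually_at_right_less[of 0]
      by eventually_elim (simp add: q_def \<xi>0 algebra_simps)
    ultimately have "((\<lambda>t. q t - d) \<longlongrightarrow> 0) (at_right 0)"
      by (rule Lim_transform_eventually)
    then show ?thesis by (rule LIM_zero_cancel)
  qed
  have \<xi>lim: "(\<xi> \<longlongrightarrow> x) (at_right 0)"
    using has_vector_derivative_continuous[OF \<xi>'] by (simp add: continuous_within \<xi>0)
  have *: "0 \<le> d \<bullet> H d + e * (norm d)\<^sup>2" if "e > 0" for e
  proof -
    obtain \<delta> where "\<delta> > 0"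
      and \<delta>: "\<And>z. norm (z - x) < \<delta> \<Longrightarrow> norm (G z - H (z - x)) \<le> e * norm (z - x)"
      using der2 \<open>e > 0\<close> unfolding has_derivative_at_alt crit by auto
    have "\<forall>\<^sub>F t in at_right 0. dist (\<xi> t) x < \<delta>"
      using \<xi>lim \<open>\<delta> > 0\<close> by (rule tendstoD)
    then have "\<forall>\<^sub>F t in at_right 0. 0 \<le> q t \<bullet> H (q t) + e * (norm (q t))\<^sup>2"
      using min eventually_at_right_less[of 0]
    proof eventually_elim
      case (elim t)
      define w where "w = \<xi> t - x"
      have "((\<lambda>s. L (x + s *\<^sub>R w)) has_derivative (\<lambda>r. (r *\<^sub>R w) \<bullet> G (x + s *\<^sub>R w))) (at s within {0..1})"
        for s :: real
        by (rule has_derivative_compose[OF _ der[unfolded gderiv_def], where f = "\<lambda>s. x + s *\<^sub>R w"])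
          (auto intro!: derivative_eq_intros)
      from mvt_simple[OF zero_less_one this]
      obtain s where s: "0 < s" "s < 1" "L (x + w) - L x = w \<bullet> G (x + s *\<^sub>R w)"
        by auto
      have "norm (s *\<^sub>R w) < \<delta>"
        using elim(1) s(1,2) mult_left_le_one_le[of "norm w" s]
        by (simp add: w_def dist_norm)
      then have r: "norm (G (x + s *\<^sub>R w) - H (s *\<^sub>R w)) \<le> e * norm (s *\<^sub>R w)"
        using \<delta>[of "x + s *\<^sub>R w"] by simp
      have "0 \<le> w \<bullet> G (x + s *\<^sub>R w)"
        using elim(2) s(3) by (simp add: w_def)
      also have "\<dots> = w \<bullet> H (s *\<^sub>R w) + w \<bullet> (G (x + s *\<^sub>R w) - H (s *\<^sub>R w))"
        by (simp add: inner_diff_right)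
      also have "w \<bullet> (G (x + s *\<^sub>R w) - H (s *\<^sub>R w)) \<le> norm w * (e * norm (s *\<^sub>R w))"
        using r by (meson norm_cauchy_schwarz order_trans mult_left_mono norm_ge_zero)
      finally have "0 \<le> s * (w \<bullet> H w + e * (norm w)\<^sup>2)"
        using s(1) by (simp add: linear_cmul[OF bounded_linear.linear[OF bl]] algebra_simps power2_eq_square)
      then have "0 \<le> w \<bullet> H w + e * (norm w)\<^sup>2"
        using s(1) by (simp add: zero_le_mult_iff)
      then have "0 \<le> (1 / t)\<^sup>2 * (w \<bullet> H w + e * (norm w)\<^sup>2)"
        by simp
      also have "\<dots> = q t \<bullet> H (q t) + e * (norm (q t))\<^sup>2"
        unfolding q_def w_def[symmetric]
        by (simp add: linear_cmul[OF bounded_linear.linear[OF bl]] algebra_simps power2_eq_square)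
      finally show ?case .
    qed
    moreover have "((\<lambda>t. q t \<bullet> H (q t) + e * (norm (q t))\<^sup>2) \<longlongrightarrow> d \<bullet> H d + e * (norm d)\<^sup>2) (at_right 0)"
      by (intro tendsto_intros q bounded_linear.tendsto[OF bl])
    ultimately show ?thesis
      by (intro tendsto_lowerbound) auto
  qed
  have "((\<lambda>e. d \<bullet> H d + e * (norm d)\<^sup>2) \<longlongrightarrow> d \<bullet> H d + 0 * (norm d)\<^sup>2) (at_right 0)"
    by (intro tendsto_intros)
  moreover have "\<forall>\<^sub>F e in at_right 0. 0 \<le> d \<bullet> H d + e * (norm d)\<^sup>2"
    using eventually_at_right_less[of 0] by (rule eventually_mono) (rule *)
  ultimately have "0 \<le> d \<bullet> H d + 0 * (norm d)\<^sup>2"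
    by (rule tendsto_lowerbound) simp
  then show ?thesis by simp
qed

text \<open>
  The curve is made to keep the equality constraints and the constraints in the set \<open>J\<close> of active
  inequalities that are stationary to first order along \<open>d\<close>: the velocity \<open>d\<close> alone does not
  determine the sign of the latter, whereas it makes the other active ones decrease.
\<close>

lemma second_order_necessary_condition_LICQ:
  fixes f :: "'a::euclidean_space \<Rightarrow> real" and g :: "'i \<Rightarrow> 'a \<Rightarrow> real" and c :: "'j \<Rightarrow> 'a \<Rightarrow> real"
  assumes finM: "finite M" and finE: "finite E"
    and f: "\<And>z. GDERIV f z :> F z" "(F has_derivative F') (at x)"
    and g: "\<And>i z. i \<in> M \<Longrightarrow> GDERIV (g i) z :> G i z"
      "\<And>i. i \<in> M \<Longrightarrow> continuous_on UNIV (G i)"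
      "\<And>i. i \<in> M \<Longrightarrow> (G i has_derivative G' i) (at x)"
    and c: "\<And>j z. j \<in> E \<Longrightarrow> GDERIV (c j) z :> C j z"
      "\<And>j. j \<in> E \<Longrightarrow> continuous_on UNIV (C j)"
      "\<And>j. j \<in> E \<Longrightarrow> (C j has_derivative C' j) (at x)"
    and feas: "\<And>i. i \<in> M \<Longrightarrow> g i x \<le> 0" "\<And>j. j \<in> E \<Longrightarrow> c j x = 0"
    and min: "\<forall>\<^sub>F z in nhds x. (\<forall>i\<in>M. g i z \<le> 0) \<longrightarrow> (\<forall>j\<in>E. c j z = 0) \<longrightarrow> f x \<le> f z"
    and LICQ: "independent_family (case_sum (\<lambda>i. G i x) (\<lambda>j. C j x)) ({i \<in> M. g i x = 0} <+> E)"
    and stat: "F x + (\<Sum>i\<in>M. lam i *\<^sub>R G i x) + (\<Sum>j\<in>E. mu j *\<^sub>R C j x) = 0"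
    and compl: "\<And>i. i \<in> M \<Longrightarrow> 0 \<le> lam i" "\<And>i. i \<in> M \<Longrightarrow> lam i * g i x = 0"
    and crit: "F x \<bullet> d \<le> 0" "\<And>i. i \<in> M \<Longrightarrow> g i x = 0 \<Longrightarrow> G i x \<bullet> d \<le> 0"
      "\<And>j. j \<in> E \<Longrightarrow> C j x \<bullet> d = 0"
  shows "0 \<le> d \<bullet> (F' d + (\<Sum>i\<in>M. lam i *\<^sub>R G' i d) + (\<Sum>j\<in>E. mu j *\<^sub>R C' j d))"
proof -
  define J where "J = {i \<in> M. g i x = 0 \<and> G i x \<bullet> d = 0}"
  \<comment> \<open>Pairing the stationarity equation with \<open>d\<close> makes the sum of the nonpositive terms
    \<open>lam i * (G i x \<bullet> d)\<close> equal to \<open>- (F x \<bullet> d)\<close>, which is nonnegative: all terms vanish. With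
    complementarity, the multipliers are zero outside \<open>J\<close>.\<close>
  have nonpos: "lam i * (G i x \<bullet> d) \<le> 0" if "i \<in> M" for i
    using compl[OF that] crit(2)[OF that] by (cases "g i x = 0") (auto simp: mult_nonneg_nonpos)
  have "0 = (F x + (\<Sum>i\<in>M. lam i *\<^sub>R G i x) + (\<Sum>j\<in>E. mu j *\<^sub>R C j x)) \<bullet> d"
    by (simp add: stat)
  also have "\<dots> = F x \<bullet> d + (\<Sum>i\<in>M. lam i * (G i x \<bullet> d))"
    by (simp add: inner_add_left inner_sum_left crit(3))
  finally have "(\<Sum>i\<in>M. lam i * (G i x \<bullet> d)) = 0"
    using crit(1) sum_nonpos[of M "\<lambda>i. lam i * (G i x \<bullet> d)"] nonpos by fastforce
  then have "\<forall>i\<in>M. lam i * (G i x \<bullet> d) = 0"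
    using sum_nonneg_eq_0_iff[OF finM, of "\<lambda>i. - (lam i * (G i x \<bullet> d))"] nonpos
    by (simp add: sum_negf)
  then have lam0: "lam i = 0" if "i \<in> M" "i \<notin> J" for i
    using that compl(2) by (auto simp: J_def)
  define L where "L z = f z + (\<Sum>i\<in>M. lam i * g i z) + (\<Sum>j\<in>E. mu j * c j z)" for z
  have L: "GDERIV L z :> F z + (\<Sum>i\<in>M. lam i *\<^sub>R G i z) + (\<Sum>j\<in>E. mu j *\<^sub>R C j z)" for z
    unfolding gderiv_def L_def
    by (auto intro!: derivative_eq_intros f(1)[unfolded gderiv_def] g(1)[unfolded gderiv_def]
        c(1)[unfolded gderiv_def] simp: inner_add_right inner_sum_right)
  have L': "((\<lambda>z. F z + (\<Sum>i\<in>M. lam i *\<^sub>R G i z) + (\<Sum>j\<in>E. mu j *\<^sub>R C j z)) has_derivative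
      (\<lambda>u. F' u + (\<Sum>i\<in>M. lam i *\<^sub>R G' i u) + (\<Sum>j\<in>E. mu j *\<^sub>R C' j u))) (at x)"
    by (intro has_derivative_add has_derivative_sum has_derivative_scaleR_right f(2) g(3) c(3))
  have split: "(\<lambda>k. case_sum G C k z) = case_sum (\<lambda>i. G i z) (\<lambda>j. C j z)" for z
    by (auto simp: fun_eq_iff split: sum.split)
  have "finite (J <+> E)"
    using finM finE by (simp add: J_def)
  moreover have "independent_family (\<lambda>k. case_sum G C k x) (J <+> E)"
    unfolding split using LICQ
    by (rule independent_family_subset) (auto simp: J_def)
  moreover have "GDERIV (case_sum g c k) z :> case_sum G C k z" if "k \<in> J <+> E" for k z
    using that g(1) c(1) by (auto simp: J_def)
  moreover have "continuous_on UNIV (case_sum G C k)" if "k \<in> J <+> E" for k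
    using that g(2) c(2) by (auto simp: J_def)
  moreover have "case_sum g c k x = 0" "case_sum G C k x \<bullet> d = 0" if "k \<in> J <+> E" for k
    using that feas(2) crit(3) by (auto simp: J_def)
  ultimately obtain \<xi> where \<xi>0: "\<xi> 0 = x" and \<xi>': "(\<xi> has_vector_derivative d) (at 0)"
    and \<xi>: "\<forall>\<^sub>F t in nhds 0. \<forall>k\<in>J <+> E. case_sum g c k (\<xi> t) = 0"
    using zero_set_curve_with_tangent[of "J <+> E" "case_sum g c" "case_sum G C" x d] by blast
  have \<xi>r: "(\<xi> has_vector_derivative d) (at_right 0)"
    using \<xi>' by (rule has_vector_derivative_at_within)
  have \<xi>lim: "filterlim \<xi> (nhds x) (at_right 0)"
    using has_vector_derivative_continuous[OF \<xi>r] by (simp add: continuous_within \<xi>0)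
  have eqs: "\<forall>\<^sub>F t in at_right 0. (\<forall>i\<in>J. g i (\<xi> t) = 0) \<and> (\<forall>j\<in>E. c j (\<xi> t) = 0)"
    using filter_leD[OF at_within_le_nhds \<xi>]
  proof (rule eventually_mono, intro conjI ballI)
    fix t i assume "\<forall>k\<in>J <+> E. case_sum g c k (\<xi> t) = 0" "i \<in> J"
    then show "g i (\<xi> t) = 0" by (metis InlI sum.case(1))
  next
    fix t j assume "\<forall>k\<in>J <+> E. case_sum g c k (\<xi> t) = 0" "j \<in> E"
    then show "c j (\<xi> t) = 0" by (metis InrI sum.case(2))
  qed
  have ineq: "\<forall>\<^sub>F t in at_right 0. g i (\<xi> t) \<le> 0" if "i \<in> M" "i \<notin> J" for i
  proof (cases "g i x = 0")
    case False
    then have "g i x < 0" using feas(1) that(1) by fastforce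
    moreover have "isCont (g i) x"
      using g(1)[OF that(1), of x] unfolding gderiv_def by (rule has_derivative_continuous)
    then have "((\<lambda>t. g i (\<xi> t)) \<longlongrightarrow> g i x) (at_right 0)"
      using \<xi>lim by (rule isCont_tendsto_compose)
    ultimately show ?thesis
      using order_tendstoD(2) by (force elim: eventually_mono)
  next
    case True
    then have neg: "d \<bullet> G i x < 0"
      using crit(2)[OF that(1)] that by (auto simp: J_def inner_commute)
    have "((\<lambda>t. g i (\<xi> t)) has_derivative (\<lambda>r. (r *\<^sub>R d) \<bullet> G i x)) (at 0)"
      using has_derivative_compose[OF \<xi>'[unfolded has_vector_derivative_def], of "g i" "\<lambda>h. h \<bullet> G i x"]
        g(1)[OF that(1), of x] by (simp add: gderiv_def \<xi>0)
    then have "DERIV (\<lambda>t. g i (\<xi> t)) 0 :> d \<bullet> G i x"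
      by (simp add: has_field_derivative_def mult.commute[of _ "d \<bullet> G i x"])
    from DERIV_neg_dec_right[OF this neg] obtain b where "b > 0"
      "\<And>h. 0 < h \<Longrightarrow> h < b \<Longrightarrow> g i (\<xi> h) < g i (\<xi> 0)" by auto
    then show ?thesis
      unfolding eventually_at_right_field using True \<xi>0 by (metis less_imp_le)
  qed
  have "\<forall>\<^sub>F t in at_right 0. \<forall>i\<in>M - J. g i (\<xi> t) \<le> 0"
    using finM ineq by (intro eventually_ball_finite) auto
  moreover have "\<forall>\<^sub>F t in at_right 0. (\<forall>i\<in>M. g i (\<xi> t) \<le> 0) \<longrightarrow> (\<forall>j\<in>E. c j (\<xi> t) = 0) \<longrightarrow> f x \<le> f (\<xi> t)"
    using min \<xi>lim by (rule eventually_compose_filterlim)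
  ultimately have "\<forall>\<^sub>F t in at_right 0. L x \<le> L (\<xi> t)"
    using eqs
  proof eventually_elim
    case (elim t)
    have "\<forall>i\<in>M. g i (\<xi> t) \<le> 0"
      using elim(1,3) by (metis DiffI order_refl)
    then have "f x \<le> f (\<xi> t)"
      using elim(2,3) by blast
    moreover have "lam i * g i (\<xi> t) = 0" if "i \<in> M" for i
      using that lam0 elim(3) by (cases "i \<in> J") auto
    then have "(\<Sum>i\<in>M. lam i * g i (\<xi> t)) = 0"
      by (intro sum.neutral) blast
    then have "L (\<xi> t) = f (\<xi> t)"
      using elim(3) by (simp add: L_def)
    moreover have "(\<Sum>i\<in>M. lam i * g i x) = 0"
      using compl(2) by (intro sum.neutral) blast
    then have "L x = f x"
      using feas(2) by (simp add: L_def)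
    ultimately show ?case by simp
  qed
  then show ?thesis
    by (rule second_order_along_curve[OF L stat L' \<xi>0 \<xi>r])
qed

section \<open>The cardinality-constrained problem\<close>

lemma matrix_vector_mult_sum_left:
  fixes A :: "'k \<Rightarrow> real ^ 'n ^ 'm"
  shows "(\<Sum>k\<in>S. A k) *v v = (\<Sum>k\<in>S. A k *v v)"
  by (induction S rule: infinite_finite_induct) (simp_all add: matrix_vector_mult_add_rdistrib)

lemma feasible_R_fixed_y:
  assumes "(x, y) \<in> feasible_R m g p h \<kappa>"
    and "z \<in> constraint_set m g p h" and "\<And>i. y $ i \<noteq> 0 \<Longrightarrow> z $ i = 0"
  shows "(z, y) \<in> feasible_R m g p h \<kappa>"
  using assms unfolding feasible_R_def by (auto simp: vec_eq_iff)

lemma support_y_subset_zero_set: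
  assumes "(x, y) \<in> feasible_R m g p h \<kappa>" and "y $ i \<noteq> 0"
  shows "i \<in> I_01 x y \<union> I_0p x y"
proof -
  have "x $ i * y $ i = 0" "0 \<le> y $ i" "y $ i \<le> 1"
    using assms(1) by (auto simp: feasible_R_def vec_eq_iff less_eq_vec_def)
  with assms(2) show ?thesis
    by (auto simp: I_01_def I_0p_def)
qed

theorem theorem3p5:
  fixes f :: "real ^ 'n \<Rightarrow> real"
    and m p :: nat
    and g h :: "nat \<Rightarrow> real ^ 'n \<Rightarrow> real"
    and \<kappa> :: int
    and x y gam :: "real ^ 'n"
    and lam mu :: "nat \<Rightarrow> real"
  assumes "\<kappa> < int CARD('n)"
    and "{x \<in> constraint_set m g p h. int (norm0 x) \<le> \<kappa>} \<noteq> {}"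
    and "twice_continuously_differentiable f"
    and "\<And>i. i \<in> {1..m} \<Longrightarrow> twice_continuously_differentiable (g i)"
    and "\<And>i. i \<in> {1..p} \<Longrightarrow> twice_continuously_differentiable (h i)"
    and "local_min_R f m g p h \<kappa> x y"
    and "CC_LICQ m g p h x"
    and "S_stationary_multipliers f m g p h \<kappa> x y lam mu gam"
  shows "\<forall>(dx, dy) \<in> CC_critical_cone f m g p h \<kappa> x y.
           dx \<bullet> ((hessian f x + (\<Sum>i=1..m. lam i *\<^sub>R hessian (g i) x)
                    + (\<Sum>i=1..p. mu i *\<^sub>R hessian (h i) x)) *v dx) \<ge> 0"
proof (intro ballI, clarify)
  fix dx dy
  assume "(dx, dy) \<in> CC_critical_cone f m g p h \<kappa> x y"
  then have crit_f: "gradient f x \<bullet> dx \<le> 0"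
    and crit_g: "\<And>i. i \<in> {1..m} \<Longrightarrow> g i x = 0 \<Longrightarrow> gradient (g i) x \<bullet> dx \<le> 0"
    and crit_h: "\<And>i. i \<in> {1..p} \<Longrightarrow> gradient (h i) x \<bullet> dx = 0"
    and crit_x: "\<And>i. i \<in> I_01 x y \<union> I_0p x y \<Longrightarrow> axis i 1 \<bullet> dx = 0"
    unfolding CC_critical_cone_def CC_linearisation_cone_def I_g_def by auto
  have feas: "(x, y) \<in> feasible_R m g p h \<kappa>"
    and stat: "gradient f x + (\<Sum>i=1..m. lam i *\<^sub>R gradient (g i) x)
       + (\<Sum>i=1..p. mu i *\<^sub>R gradient (h i) x) + (\<Sum>i\<in>UNIV. gam $ i *\<^sub>R axis i 1) = 0"
    and compl: "\<And>i. i \<in> {1..m} \<Longrightarrow> 0 \<le> lam i" "\<And>i. i \<in> {1..m} \<Longrightarrow> lam i * g i x = 0"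
    and gam0: "\<And>i. i \<in> I_pm0 x y \<union> I_00 x y \<Longrightarrow> gam $ i = 0"
    using assms(8) unfolding S_stationary_multipliers_def by auto
  have C2: "GDERIV F z :> gradient F z" "continuous_on UNIV (gradient F)"
      "(gradient F has_derivative (\<lambda>v. hessian F x *v v)) (at x)"
    if "twice_continuously_differentiable F" for F :: "real ^ 'n \<Rightarrow> real" and z
    using that gderiv_gradient gradient_has_derivative_hessian[OF that]
    by (auto simp: twice_continuously_differentiable_def continuous_on_eq_continuous_at
        intro: differentiable_imp_continuous_within)
  \<comment> \<open>The nonlinear program for the frozen \<open>y\<close>: equality constraints \<open>h i\<close> together with the
    coordinates in the support \<open>K\<close> of \<open>y\<close>.\<close>
  define K where "K = {i. y $ i \<noteq> 0}"
  define E where "E = {1..p} <+> K"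
  define c where "c = case_sum h (\<lambda>i z. z $ i)"
  define C where "C = case_sum (\<lambda>i. gradient (h i)) (\<lambda>i z. axis i (1::real))"
  define C' where "C' = case_sum (\<lambda>i v. hessian (h i) x *v v) (\<lambda>(i::'n) v. 0)"
  define mu' where "mu' = case_sum mu (\<lambda>i. gam $ i)"
  have K: "i \<in> I_01 x y \<union> I_0p x y" "x $ i = 0" if "i \<in> K" for i
    using support_y_subset_zero_set[OF feas, of i] that by (auto simp: K_def I_01_def I_0p_def)
  obtain \<epsilon> where "\<epsilon> > 0"
    and \<epsilon>: "\<forall>w \<in> feasible_R m g p h \<kappa> \<inter> ball (x, y) \<epsilon>. f x \<le> f (fst w)"
    using assms(6) unfolding local_min_R_def local_min_on_def
    by (auto simp: case_prod_unfold)
  have min: "\<forall>\<^sub>F z in nhds x. (\<forall>i\<in>{1..m}. g i z \<le> 0) \<longrightarrow> (\<forall>j\<in>E. c j z = 0) \<longrightarrow> f x \<le> f z"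
    unfolding eventually_nhds_metric
  proof (intro exI[of _ \<epsilon>] conjI allI impI)
    fix z
    assume z: "dist z x < \<epsilon>" "\<forall>i\<in>{1..m}. g i z \<le> 0" "\<forall>j\<in>E. c j z = 0"
    have "h i z = 0" if "i \<in> {1..p}" for i
      using z(3) that by (auto simp: E_def c_def dest: bspec[of _ _ "Inl i"])
    moreover have "z $ i = 0" if "y $ i \<noteq> 0" for i
      using z(3) that by (auto simp: E_def c_def K_def dest: bspec[of _ _ "Inr i"])
    ultimately have "(z, y) \<in> feasible_R m g p h \<kappa>"
      using z(2) by (intro feasible_R_fixed_y[OF feas]) (auto simp: constraint_set_def)
    then show "f x \<le> f z"
      using \<epsilon> z(1) by (auto simp: dist_Pair_Pair dist_commute dest: bspec[of _ _ "(z, y)"])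
  qed (rule \<open>\<epsilon> > 0\<close>)
  have LICQ: "independent_family (case_sum (\<lambda>i. gradient (g i) x) (\<lambda>j. C j x)) ({i \<in> {1..m}. g i x = 0} <+> E)"
  proof -
    have "(\<lambda>j. C j x) = case_sum (\<lambda>i. gradient (h i) x) (\<lambda>i. axis i 1)"
      by (auto simp: C_def fun_eq_iff split: sum.split)
    then show ?thesis
      using assms(7) K(2) unfolding CC_LICQ_def
      by (auto simp: E_def I_g_def I_0_def elim!: independent_family_subset)
  qed
  have "(\<Sum>i\<in>UNIV. gam $ i *\<^sub>R axis i (1::real)) = (\<Sum>i\<in>K. gam $ i *\<^sub>R axis i 1)"
    using gam0 by (intro sum.mono_neutral_right) (auto simp: K_def I_pm0_def I_00_def)
  then have stat': "gradient f x + (\<Sum>i=1..m. lam i *\<^sub>R gradient (g i) x) + (\<Sum>j\<in>E. mu' j *\<^sub>R C j x) = 0"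
    using stat by (simp add: E_def mu'_def C_def sum.Plus add.assoc)
  have coord: "GDERIV (\<lambda>z. z $ i) z :> axis i 1" for i and z :: "real ^ 'n"
    by (simp add: gderiv_def inner_axis bounded_linear_imp_has_derivative bounded_linear_vec_nth)
  have "0 \<le> dx \<bullet> (hessian f x *v dx + (\<Sum>i=1..m. lam i *\<^sub>R (hessian (g i) x *v dx))
      + (\<Sum>j\<in>E. mu' j *\<^sub>R C' j dx))"
  proof (rule second_order_necessary_condition_LICQ[where f = f and g = g and c = c
        and F = "gradient f" and F' = "\<lambda>v. hessian f x *v v"
        and G = "\<lambda>i. gradient (g i)" and G' = "\<lambda>i v. hessian (g i) x *v v"
        and C = C and C' = C', OF _ _ C2(1,3)[OF assms(3)] C2[OF assms(4)]
        _ _ _ _ _ min LICQ stat' compl crit_f crit_g])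
    show "finite E" by (simp add: E_def)
    show "GDERIV (c j) z :> C j z" "continuous_on UNIV (C j)" "(C j has_derivative C' j) (at x)"
      "c j x = 0" "C j x \<bullet> dx = 0" if "j \<in> E" for j z
      using that C2[OF assms(5)] coord feas K crit_h crit_x
      by (auto simp: E_def c_def C_def C'_def feasible_R_def constraint_set_def)
    show "g i x \<le> 0" if "i \<in> {1..m}" for i
      using that feas by (auto simp: feasible_R_def constraint_set_def)
  qed auto
  also have "(\<Sum>j\<in>E. mu' j *\<^sub>R C' j dx) = (\<Sum>i=1..p. mu i *\<^sub>R (hessian (h i) x *v dx))"
    by (simp add: E_def mu'_def C'_def sum.Plus)
  finally show "0 \<le> dx \<bullet> ((hessian f x + (\<Sum>i=1..m. lam i *\<^sub>R hessian (g i) x)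
                    + (\<Sum>i=1..p. mu i *\<^sub>R hessian (h i) x)) *v dx)"
    by (simp add: matrix_vector_mult_add_rdistrib matrix_vector_mult_sum_left
        scaleR_matrix_vector_assoc)
qed

end
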